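(* Let $f:\mathbb{R}\to\mathbb{R}$ be defined by $f(t)=e^{-1/t}$ for $t>0$ and $f(t)=0$ for $t\le 0$. Then $f$ is infinitely differentiable on $\mathbb{R}$ and $f^{(i)}(0)=0$ for all $i\in\mathbb{N}\cup\{0\}$, but $f$ is not analytic at $t=0$.
   Context: $\mathbb{N}$ denotes the set of positive integers; $f^{(i)}$ denotes the $i$-th derivative of $f$, with $f^{(0)}=f$. A real function $q(t)$ is said to be analytic at a point $t_0$ if it possesses derivatives of all orders and agrees with its Taylor series (at $t_0$) in a neighborhood of $t_0$. *)

theory Defs
  imports "HOL-Analysis.Analysis"
begin

text \<open>
  The \<open>k\<close>-th derivative of \<open>f\<close> is \<open>(deriv ^^ k) f\<close>. Since \<open>deriv\<close> is total, its values are meaningful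
  only where the derivative exists, so differentiability is always required explicitly.
\<close>

definition infinitely_differentiable :: "(real \<Rightarrow> real) \<Rightarrow> bool" where
  "infinitely_differentiable f \<longleftrightarrow> (\<forall>k t. (deriv ^^ k) f differentiable (at t))"

text \<open>
  For the derivative of order \<open>k + 1\<close> to exist at \<open>t\<^sub>0\<close>, the one of order \<open>k\<close> has to exist throughout
  a neighborhood of \<open>t\<^sub>0\<close>, which may shrink as \<open>k\<close> grows. Asking for differentiability at \<open>t\<^sub>0\<close>
  only would not do, because \<open>deriv\<close> takes an arbitrary value at neighboring points where the
  derivative does not exist.
\<close>

definition has_all_derivatives_at :: "(real \<Rightarrow> real) \<Rightarrow> real \<Rightarrow> bool" where
  "has_all_derivatives_at q t\<^sub>0 \<longleftrightarrow>
     (\<forall>k. \<forall>\<^sub>F t in nhds t\<^sub>0. (deriv ^^ k) q differentiable (at t))"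

definition real_analytic_at :: "(real \<Rightarrow> real) \<Rightarrow> real \<Rightarrow> bool" where
  "real_analytic_at q t\<^sub>0 \<longleftrightarrow>
     has_all_derivatives_at q t\<^sub>0 \<and>
     (\<forall>\<^sub>F t in nhds t\<^sub>0. (\<lambda>k. (deriv ^^ k) q t\<^sub>0 / fact k * (t - t\<^sub>0) ^ k) sums q t)"

end

theory Submission
  imports Defs
begin

text \<open>
  For \<open>t > 0\<close>, the derivative of \<open>p(1/t) e\<^bsup>-1/t\<^esup>\<close>, with \<open>p\<close> a polynomial, is
  \<open>q(1/t) e\<^bsup>-1/t\<^esup>\<close> with \<open>q(x) = x\<^sup>2 (p(x) - p'(x))\<close>. Extended by \<open>0\<close> to \<open>t \<le> 0\<close>, functions of
  this form are also differentiable at \<open>0\<close>, with derivative \<open>0\<close>, because \<open>x p(x) e\<^bsup>-x\<^esup>\<close>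
  tends to \<open>0\<close> as \<open>x = 1/t\<close> tends to infinity. So this class of functions, which contains \<open>f\<close>
  (take \<open>p = 1\<close>), is closed under differentiation (\<open>has_real_derivative_flat\<close>), and all its members
  are differentiable everywhere and vanish at \<open>0\<close>. The Taylor series of \<open>f\<close> at \<open>0\<close> is therefore
  identically \<open>0\<close>, whereas \<open>f\<close> is positive at points arbitrarily close to \<open>0\<close>.
\<close>

text \<open>
  The function \<open>p(1/t) e\<^bsup>-1/t\<^esup>\<close> on the positive reals, extended by \<open>0\<close>.
\<close>

definition flat :: "real poly \<Rightarrow> real \<Rightarrow> real" where
  "flat p t = (if t > 0 then poly p (1 / t) * exp (- 1 / t) else 0)"

lemma poly_times_exp_minus_tendsto_0:
  fixes p :: "real poly"
  shows "((\<lambda>x. poly p x * exp (- x)) \<longlongrightarrow> 0) at_top"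
proof -
  have "((\<lambda>x. \<Sum>i\<le>degree p. coeff p i * (x ^ i / exp x)) \<longlongrightarrow> (\<Sum>i\<le>degree p. coeff p i * 0)) at_top"
    by (intro tendsto_intros tendsto_power_div_exp_0)
  moreover have "(\<lambda>x. \<Sum>i\<le>degree p. coeff p i * (x ^ i / exp x)) = (\<lambda>x. poly p x * exp (- x))"
    by (simp add: fun_eq_iff poly_altdef sum_distrib_right exp_minus divide_inverse mult.assoc)
  ultimately show ?thesis by simp
qed

lemma flat_tendsto_0_at_right: "(flat p \<longlongrightarrow> 0) (at_right 0)"
proof -
  have "((\<lambda>t. poly p (inverse t) * exp (- inverse t)) \<longlongrightarrow> 0) (at_right 0)"
    using filterlim_compose[OF poly_times_exp_minus_tendsto_0 filterlim_inverse_at_top_right] .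
  moreover have "\<forall>\<^sub>F t in at_right 0. poly p (inverse t) * exp (- inverse t) = flat p t"
    using eventually_at_right_less[of "0::real"]
    by eventually_elim (simp add: flat_def inverse_eq_divide)
  ultimately show ?thesis
    by (rule Lim_transform_eventually)
qed

lemma has_real_derivative_flat:
  "(flat p has_real_derivative flat ([:0, 0, 1:] * (p - pderiv p)) t) (at t)"
proof -
  consider "t > 0" | "t < 0" | "t = 0" by linarith
  then show ?thesis
  proof cases
    case 1
    have "((\<lambda>t. poly p (1 / t) * exp (- 1 / t)) has_real_derivative
        flat ([:0, 0, 1:] * (p - pderiv p)) t) (at t)"
      using 1 by (auto intro!: derivative_eq_intros DERIV_chain2[OF poly_DERIV]
          simp: flat_def field_simps power2_eq_square)
    then show ?thesis
      by (rule has_field_derivative_transform_within_open[of _ _ _ "{0<..}"])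
        (use 1 in \<open>auto simp: flat_def\<close>)
  next
    case 2
    have "((\<lambda>t. 0) has_real_derivative flat ([:0, 0, 1:] * (p - pderiv p)) t) (at t)"
      using 2 by (simp add: flat_def)
    then show ?thesis
      by (rule has_field_derivative_transform_within_open[of _ _ _ "{..<0}"])
        (use 2 in \<open>auto simp: flat_def\<close>)
  next
    case 3
    \<comment> \<open>The difference quotient at \<open>0\<close> is again of the form \<open>flat\<close>, for the polynomial \<open>x p(x)\<close>.\<close>
    have quotient: "(flat p h - flat p 0) / h = flat (pCons 0 p) h" for h
      by (simp add: flat_def)
    have "(flat (pCons 0 p) \<longlongrightarrow> 0) (at_left 0)"
      by (rule Lim_transform_eventually[OF tendsto_const])
        (auto simp: flat_def eventually_at_filter)
    then have "(flat (pCons 0 p) \<longlongrightarrow> 0) (at 0)"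
      using flat_tendsto_0_at_right by (simp add: filterlim_split_at)
    then have "(flat p has_real_derivative 0) (at 0)"
      by (simp add: has_field_derivative_iff quotient)
    then show ?thesis
      using 3 by (simp add: flat_def)
  qed
qed

lemma higher_deriv_flat: "\<exists>q. (deriv ^^ k) (flat p) = flat q"
proof (induction k)
  case 0
  show ?case by auto
next
  case (Suc k)
  then obtain q where "(deriv ^^ k) (flat p) = flat q" by blast
  moreover have "deriv (flat q) = flat ([:0, 0, 1:] * (q - pderiv q))"
    by (rule ext) (rule DERIV_imp_deriv[OF has_real_derivative_flat])
  ultimately have "(deriv ^^ Suc k) (flat p) = flat ([:0, 0, 1:] * (q - pderiv q))"
    by simp
  then show ?case by blast
qed

theorem theorem4:
  fixes f :: "real \<Rightarrow> real"
  assumes f_pos: "\<And>t. t > 0 \<Longrightarrow> f t = exp (- 1 / t)"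
    and f_nonpos: "\<And>t. t \<le> 0 \<Longrightarrow> f t = 0"
  shows "infinitely_differentiable f \<and> (\<forall>i. (deriv ^^ i) f 0 = 0) \<and> \<not> real_analytic_at f 0"
proof -
  have f_flat: "f = flat 1"
    using f_pos f_nonpos by (auto simp: fun_eq_iff flat_def)
  have smooth: "infinitely_differentiable f"
    unfolding infinitely_differentiable_def
  proof (intro allI)
    fix k t
    obtain q where "(deriv ^^ k) f = flat q"
      using higher_deriv_flat f_flat by blast
    then show "(deriv ^^ k) f differentiable (at t)"
      using has_real_derivative_flat real_differentiable_def by auto
  qed
  have derivs_0: "(deriv ^^ i) f 0 = 0" for i
  proof -
    obtain q where "(deriv ^^ i) f = flat q"
      using higher_deriv_flat f_flat by blast
    then show ?thesis by (simp add: flat_def)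
  qed
  have "\<not> real_analytic_at f 0"
  proof
    assume "real_analytic_at f 0"
    then have "\<forall>\<^sub>F t in nhds 0. (\<lambda>k. 0) sums f t"
      by (simp add: real_analytic_at_def derivs_0)
    then have "\<forall>\<^sub>F t in at_right 0. (\<lambda>k. 0) sums f t"
      by (auto simp: eventually_at_filter elim: eventually_mono)
    then have "\<forall>\<^sub>F t::real in at_right 0. False"
      using eventually_at_right_less[of "0::real"]
    proof eventually_elim
      case (elim t)
      then have "f t = 0"
        using sums_unique2[OF sums_zero] by metis
      then show ?case
        using f_pos[OF elim(2)] by simp
    qed
    then show False
      by simp
  qed
  with smooth derivs_0 show ?thesis by blast
qed

end
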